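(* Let $g\geq 2$ be an integer and let $a,a'\in\mathbb{N}$ satisfy $\gcd(g,a)=\gcd(a,a')=1$. Let $\mathcal{D}=\{d_1,\dots,d_t\}\subseteq\{0,\dots,g-1\}$ with $d_1<\dots<d_t$ and $t\geq 2$. Then $$\lim_{N\to\infty}\frac{|\{n\in \mathcal{C}_{g,\mathcal{D}}:\ n\equiv b \pmod a,\ S_g(n)\equiv b' \pmod{a'}\}\cap[0,N)|}{|\mathcal{C}_{g,\mathcal{D}}\cap[0,N)|}=\frac{1}{aa'}$$ for every $(b,b')\in\mathbb{Z}/a\mathbb{Z}\times\mathbb{Z}/a'\mathbb{Z}$ if and only if $\gcd(aa',d_2-d_1,\dots,d_t-d_1)=1$.
   Context: $\mathbb{N}=\{1,2,\dots\}$ and $\mathbb{N}_0=\mathbb{N}\cup\{0\}$. The missing digits set is $\mathcal{C}_{g,\mathcal{D}}=\{\sum_{i=0}^m w_ig^i:\ m\in\mathbb{N}_0,\ w_i\in\mathcal{D}\}$. $S_g(n)$ denotes the sum of the digits of $n$ in base $g$: $S_g(\sum_{i=0}^m w_ig^i)=w_0+\dots+w_m$ for $w_i\in\{0,\dots,g-1\}$. *)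

theory Defs
  imports Complex_Main "HOL-Number_Theory.Cong"
begin

definition missing_digits_set :: "nat \<Rightarrow> nat set \<Rightarrow> nat set" where
  "missing_digits_set g D = {(\<Sum>i\<le>m. w i * g ^ i) | m w. \<forall>i\<le>m. w i \<in> D}"

text \<open>The base \<open>g\<close> is meant to be at least 2; the guard \<open>g < 2\<close> only ensures termination.\<close>

function digit_sum :: "nat \<Rightarrow> nat \<Rightarrow> nat" where
  "digit_sum g n = (if g < 2 \<or> n = 0 then 0 else n mod g + digit_sum g (n div g))"
  by pat_completeness auto
termination
  by (relation "measure snd") auto

declare digit_sum.simps [simp del]

lemma digit_sum_expansion:
  assumes "g \<ge> 2" and "\<And>i. i \<le> m \<Longrightarrow> w i < g"
  shows "digit_sum g (\<Sum>i\<le>m. w i * g ^ i) = (\<Sum>i\<le>m. w i)"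
proof -
  have step: "digit_sum g (c + g * k) = c + digit_sum g k" if "c < g" for c k
  proof (cases "c + g * k = 0")
    case True
    then show ?thesis using assms(1) by (simp add: digit_sum.simps)
  next
    case False
    then have "digit_sum g (c + g * k) = (c + g * k) mod g + digit_sum g ((c + g * k) div g)"
      using assms(1) digit_sum.simps[of g "c + g * k"] by (metis not_le)
    moreover have "(c + g * k) mod g = c" "(c + g * k) div g = k"
      using that by simp_all
    ultimately show ?thesis
      by (simp only:)
  qed
  show ?thesis
    using assms(2)
  proof (induction m arbitrary: w)
    case 0
    then show ?case using step[of "w 0" 0] by (simp add: digit_sum.simps)
  next
    case (Suc m)
    have "(\<Sum>i\<le>Suc m. w i * g ^ i) = w 0 + g * (\<Sum>i\<le>m. w (Suc i) * g ^ i)"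
      by (subst sum.atMost_Suc_shift) (simp add: sum_distrib_left mult_ac)
    then have "digit_sum g (\<Sum>i\<le>Suc m. w i * g ^ i)
        = w 0 + digit_sum g (\<Sum>i\<le>m. w (Suc i) * g ^ i)"
      using step Suc.prems by simp
    also have "\<dots> = w 0 + (\<Sum>i\<le>m. w (Suc i))"
      using Suc.IH[of "\<lambda>i. w (Suc i)"] Suc.prems by simp
    also have "\<dots> = (\<Sum>i\<le>Suc m. w i)"
      by (rule sum.atMost_Suc_shift[symmetric])
    finally show ?case .
  qed
qed

end

theory Submission
  imports Defs
begin

text \<open>
  Since \<open>a\<close> and \<open>a'\<close> are coprime, the two congruences amount to prescribing
  \<open>a' * n + a * S(n)\<close> modulo \<open>A = a * a'\<close>. On strings of \<open>K\<close> free digits this is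
  a sum of independent terms \<open>w\<^sub>i * c\<^sub>i\<close>, where \<open>c\<^sub>i = a' * g ^ i + a\<close> is coprime to \<open>A\<close>,
  so its character sums factor. By the gcd condition each factor of a nontrivial character
  is smaller than the number \<open>t\<close> of digits by a uniform ratio \<open>\<rho> < 1\<close>.
  Up to at most \<open>2 * g ^ K\<close> elements, an initial segment of the missing digits set is a union
  of translates of the set of these strings, which gives a relative error \<open>\<rho> ^ K + o(1)\<close>.
  Conversely, if a common divisor \<open>m\<close> of \<open>A\<close> and the digit differences exceeds 1, then
  \<open>a' * n + a * S(n)\<close> is constant modulo \<open>m\<close> on numbers of equal length, while these
  numbers make up a positive proportion of the initial segments up to powers of \<open>g\<close>.
\<close>

section \<open>Characters of the integers modulo A\<close>

definition additive_char :: "nat \<Rightarrow> int \<Rightarrow> complex" where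
  "additive_char A m = cis (2 * pi * real_of_int m / real A)"

lemma norm_additive_char [simp]: "norm (additive_char A m) = 1"
  by (simp add: additive_char_def)

lemma additive_char_0 [simp]: "additive_char A 0 = 1"
  by (simp add: additive_char_def)

lemma additive_char_add: "additive_char A (m + n) = additive_char A m * additive_char A n"
  by (simp add: additive_char_def cis_mult ring_distribs add_divide_distrib)

lemma additive_char_power: "additive_char A m ^ k = additive_char A (int k * m)"
  by (induction k) (simp_all add: ring_distribs additive_char_add)

lemma additive_char_eq_1_iff:
  assumes "A > 0"
  shows "additive_char A m = 1 \<longleftrightarrow> int A dvd m"
proof
  assume "additive_char A m = 1"
  then have "cos (2 * pi * real_of_int m / real A) = 1"
    by (simp add: additive_char_def complex_eq_iff)
  then obtain k :: int where "2 * pi * real_of_int m / real A = real_of_int k * 2 * pi"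
    using cos_one_2pi_int by blast
  then have "real_of_int m = real_of_int (k * int A)"
    using assms by (simp add: field_simps)
  then show "int A dvd m"
    unfolding of_int_eq_iff by simp
next
  assume "int A dvd m"
  then obtain k where "m = int A * k" ..
  then have "2 * pi * real_of_int m / real A = 2 * pi * real_of_int k"
    using assms by (simp add: field_simps)
  then show "additive_char A m = 1"
    by (simp add: additive_char_def cis_multiple_2pi)
qed

lemma additive_char_cong:
  assumes "A > 0" "int A dvd m - n"
  shows "additive_char A m = additive_char A n"
  using additive_char_add[of A "m - n" n] additive_char_eq_1_iff[of A "m - n"] assms by simp

lemma additive_char_eq_iff:
  assumes "A > 0"
  shows "additive_char A m = additive_char A n \<longleftrightarrow> int A dvd m - n"
proof
  assume "additive_char A m = additive_char A n"
  moreover have "additive_char A n \<noteq> 0"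
    using norm_additive_char[of A n] by force
  ultimately show "int A dvd m - n"
    using additive_char_add[of A "m - n" n] additive_char_eq_1_iff[of A "m - n"] assms by simp
qed (use assms additive_char_cong in blast)

lemma sum_additive_char:
  assumes "A > 0"
  shows "(\<Sum>k<A. additive_char A (int k * m)) = (if int A dvd m then of_nat A else 0)"
proof (cases "int A dvd m")
  case True
  then have "additive_char A m = 1"
    using assms by (simp add: additive_char_eq_1_iff)
  with True show ?thesis
    by (simp flip: additive_char_power)
next
  case False
  have "additive_char A m ^ A = 1"
    using assms by (simp add: additive_char_power additive_char_eq_1_iff)
  then show ?thesis
    using False assms
    by (simp flip: additive_char_power add: geometric_sum additive_char_eq_1_iff)
qed

section \<open>Cancellation in character sums over the digits\<close>

lemma norm_add_unit_less_2:
  fixes z w :: complex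
  assumes "norm z = 1" "norm w = 1" "z \<noteq> w"
  shows "norm (z + w) < 2"
proof -
  \<comment> \<open>Parallelogram law: the positive term \<open>norm (z - w)\<close> keeps the
    square of \<open>norm (z + w)\<close> below 4.\<close>
  have "(norm (z + w))\<^sup>2 + (norm (z - w))\<^sup>2 = 2 * (norm z)\<^sup>2 + 2 * (norm w)\<^sup>2"
    unfolding cmod_power2 by (simp add: power2_eq_square algebra_simps)
  moreover have "(norm (z - w))\<^sup>2 > 0"
    using assms by simp
  moreover have "2 * (norm z)\<^sup>2 + 2 * (norm w)\<^sup>2 = 2\<^sup>2"
    using assms by simp
  ultimately have "(norm (z + w))\<^sup>2 < 2\<^sup>2"
    by linarith
  then show ?thesis
    by (rule power_less_imp_less_base) simp
qed

text \<open>The terms at \<open>d\<close> and \<open>e\<close> are distinct points of the unit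
  circle, so together they are shorter than 2; each remaining term contributes at most 1.\<close>

lemma norm_sum_additive_char_less:
  fixes D :: "nat set"
  assumes "finite D" "A > 0" "d \<in> D" "e \<in> D" "\<not> int A dvd x * (int d - int e)"
  shows "norm (\<Sum>d\<in>D. additive_char A (x * int d)) < card D"
proof -
  let ?f = "\<lambda>d. additive_char A (x * int d)"
  have "d \<noteq> e"
    using assms(5) by auto
  have "card {d, e} = 2" "{d, e} \<subseteq> D"
    using \<open>d \<noteq> e\<close> assms(3,4) by simp_all
  then have D: "card D = 2 + card (D - {d, e})"
    using card_Diff_subset[of "{d, e}" D] card_mono[of D "{d, e}"] assms(1) by simp
  have "norm (?f d + ?f e) < 2"
    using assms(2,5) by (intro norm_add_unit_less_2)
      (simp_all add: additive_char_eq_iff right_diff_distrib)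
  moreover have "norm (\<Sum>d\<in>D - {d, e}. ?f d) \<le> card (D - {d, e})"
    using norm_sum[of ?f "D - {d, e}"] by simp
  moreover have "(\<Sum>d\<in>D. ?f d) = (?f d + ?f e) + (\<Sum>d\<in>D - {d, e}. ?f d)"
    using sum.subset_diff[of "{d, e}" D ?f] \<open>{d, e} \<subseteq> D\<close> \<open>d \<noteq> e\<close> assms(1) by simp
  ultimately show ?thesis
    using norm_triangle_ineq[of "?f d + ?f e" "\<Sum>d\<in>D - {d, e}. ?f d"] D by simp
qed

text \<open>The sum depends only on \<open>x\<close> modulo \<open>A\<close>, so it takes finitely
  many values. The largest norm strictly below \<open>card D\<close> yields one ratio \<rho> for all
  admissible \<open>x\<close>.\<close>

lemma uniform_norm_sum_additive_char:
  fixes D :: "nat set"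
  assumes "finite D" "D \<noteq> {}" "A > 0"
  obtains \<rho> :: real where "0 \<le> \<rho>" "\<rho> < 1"
    "\<And>x d e. \<lbrakk>d \<in> D; e \<in> D; \<not> int A dvd x * (int d - int e)\<rbrakk> \<Longrightarrow>
      norm (\<Sum>d\<in>D. additive_char A (x * int d)) \<le> \<rho> * card D"
proof -
  define F where "F x = norm (\<Sum>d\<in>D. additive_char A (x * int d))" for x
  \<comment> \<open>The inserted 0 keeps \<open>S\<close> nonempty even if no residue gives a short
    sum, and makes \<open>Max S\<close> nonnegative.\<close>
  define S where "S = insert 0 {y \<in> F ` {0..<int A}. y < card D}"
  have S: "finite S" "S \<noteq> {}"
    by (auto simp: S_def)
  have card: "card D > 0"
    using assms by (simp add: card_gt_0_iff)
  have "Max S \<in> S" "0 \<le> Max S"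
    using Max_in[OF S] Max_ge[OF S(1), of 0] by (simp_all add: S_def)
  have "Max S < card D"
    using \<open>Max S \<in> S\<close> card S_def by force
  have bound: "F x \<le> Max S"
    if "d \<in> D" "e \<in> D" "\<not> int A dvd x * (int d - int e)" for x d e
  proof -
    have "F x = F (x mod int A)"
      unfolding F_def using assms(3)
      by (intro arg_cong[where f = norm] sum.cong additive_char_cong)
        (simp_all flip: left_diff_distrib add: minus_mod_eq_mult_div)
    moreover have "x mod int A \<in> {0..<int A}"
      using assms(3) by simp
    moreover have "F x < card D"
      unfolding F_def using assms that by (intro norm_sum_additive_char_less)
    ultimately have "F x \<in> S"
      by (auto simp: S_def)
    then show ?thesis
      using S by simp
  qed
  show ?thesis
  proof (rule that[of "Max S / card D"])
    show "0 \<le> Max S / card D" "Max S / card D < 1"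
      using \<open>0 \<le> Max S\<close> \<open>Max S < card D\<close> card by simp_all
    show "norm (\<Sum>d\<in>D. additive_char A (x * int d)) \<le> Max S / card D * card D"
      if "d \<in> D" "e \<in> D" "\<not> int A dvd x * (int d - int e)" for x d e
      using bound[OF that] card by (simp add: F_def)
  qed
qed

section \<open>Digit blocks\<close>

lemma digit_sum_0 [simp]: "digit_sum g 0 = 0"
  by (simp add: digit_sum.simps)

lemma digit_sum_div:
  assumes "g \<ge> 2"
  shows "digit_sum g n = n mod g + digit_sum g (n div g)"
  using assms digit_sum.simps[of g n] by (cases "n = 0") auto

lemma digit_sum_digit:
  assumes "g \<ge> 2" "d < g"
  shows "digit_sum g d = d"
  using digit_sum_div[of g d] assms by simp

lemma digit_sum_append:
  assumes "g \<ge> 2" "r < g ^ K"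
  shows "digit_sum g (r + g ^ K * q) = digit_sum g r + digit_sum g q"
  using assms(2)
proof (induction K arbitrary: r)
  case 0
  then show ?case by simp
next
  case (Suc K)
  have "r div g < g ^ K"
    using Suc.prems by (simp add: less_mult_imp_div_less mult.commute)
  moreover have "(r + g ^ Suc K * q) div g = r div g + g ^ K * q"
    using assms(1) by (simp add: mult.assoc)
  moreover have "(r + g ^ Suc K * q) mod g = r mod g"
    by (simp add: mult.assoc)
  ultimately show ?case
    using digit_sum_div[OF assms(1), of "r + g ^ Suc K * q"] digit_sum_div[OF assms(1), of r]
      Suc.IH[of "r div g"] by simp
qed

text \<open>These are the values of strings of exactly \<open>K\<close> digits. Leading zeros count
  as digits here, so numbers below \<open>g ^ (K - 1)\<close> occur only if 0 is in \<open>D\<close>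
  (for \<open>K > 0\<close>).\<close>

definition digit_blocks :: "nat \<Rightarrow> nat set \<Rightarrow> nat \<Rightarrow> nat set" where
  "digit_blocks g D K = {r. r < g ^ K \<and> (\<forall>i<K. r div g ^ i mod g \<in> D)}"

text \<open>The weights are kept general because removing \<open>K\<close> low digits turns
  \<open>u\<close> into \<open>u * g ^ K\<close>; the family is thus closed under splitting. The
  theorem uses \<open>u = a'\<close> and \<open>v = a\<close>.\<close>

definition digit_stat :: "nat \<Rightarrow> nat \<Rightarrow> nat \<Rightarrow> nat \<Rightarrow> nat" where
  "digit_stat g u v n = u * n + v * digit_sum g n"

lemma finite_digit_blocks [simp]: "finite (digit_blocks g D K)"
  by (simp add: digit_blocks_def)

lemma digit_blocks_0 [simp]: "digit_blocks g D 0 = {0}"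
  by (auto simp: digit_blocks_def)

lemma digit_blocks_less: "r \<in> digit_blocks g D K \<Longrightarrow> r < g ^ K"
  by (simp add: digit_blocks_def)

lemma digit_stat_append:
  assumes "g \<ge> 2" "r < g ^ K"
  shows "digit_stat g u v (r + g ^ K * q) = digit_stat g u v r + digit_stat g (u * g ^ K) v q"
  using digit_sum_append[OF assms] by (simp add: digit_stat_def algebra_simps)

lemma digit_stat_digit:
  assumes "g \<ge> 2" "d < g"
  shows "digit_stat g u v d = (u + v) * d"
  using digit_sum_digit[OF assms] by (simp add: digit_stat_def algebra_simps)

lemma digit_append:
  fixes g :: nat
  assumes "i < K" "g > 0"
  shows "(r + g ^ K * q) div g ^ i mod g = r div g ^ i mod g"
proof -
  obtain j where "K = Suc (i + j)"
    using assms less_iff_Suc_add by auto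
  then have eq: "r + g ^ K * q = r + g ^ i * (g * (g ^ j * q))"
    by (simp add: power_add mult_ac)
  have "(r + g ^ i * (g * (g ^ j * q))) div g ^ i = g * (g ^ j * q) + r div g ^ i"
    using assms(2) by (intro div_mult_self2) simp
  then show ?thesis
    by (simp only: eq mod_mult_self4)
qed

lemma digit_blocks_Suc_iff:
  assumes "g > 0" "D \<subseteq> {..<g}" "r < g ^ K"
  shows "r + g ^ K * d \<in> digit_blocks g D (Suc K) \<longleftrightarrow> r \<in> digit_blocks g D K \<and> d \<in> D"
proof -
  have "r + g ^ K * d < g ^ Suc K \<longleftrightarrow> d < g"
    using assms div_less_iff_less_mult[of "g ^ K" "r + g ^ K * d" g] by (simp add: mult.commute)
  moreover have "(r + g ^ K * d) div g ^ K = d"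
    using assms by simp
  ultimately show ?thesis
    using assms by (auto simp: digit_blocks_def less_Suc_eq digit_append)
qed

lemma sum_digit_blocks_Suc:
  assumes "g > 0" "D \<subseteq> {..<g}"
  shows "sum f (digit_blocks g D (Suc K)) = (\<Sum>d\<in>D. \<Sum>r\<in>digit_blocks g D K. f (r + g ^ K * d))"
proof -
  have "sum f (digit_blocks g D (Suc K)) =
      (\<Sum>(d, r)\<in>D \<times> digit_blocks g D K. f (r + g ^ K * d))"
  proof (rule sum.reindex_bij_witness[where j = "\<lambda>n. (n div g ^ K, n mod g ^ K)"
        and i = "\<lambda>(d, r). r + g ^ K * d"])
    fix n assume "n \<in> digit_blocks g D (Suc K)"
    then have "n mod g ^ K + g ^ K * (n div g ^ K) \<in> digit_blocks g D (Suc K)"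
      by simp
    then show "(n div g ^ K, n mod g ^ K) \<in> D \<times> digit_blocks g D K"
      using assms digit_blocks_Suc_iff[of g D "n mod g ^ K" K "n div g ^ K"] by simp
  next
    fix x assume "x \<in> D \<times> digit_blocks g D K"
    then show "(case x of (d, r) \<Rightarrow> r + g ^ K * d) \<in> digit_blocks g D (Suc K)"
      using digit_blocks_Suc_iff[OF assms] digit_blocks_less by auto
  qed (use assms digit_blocks_less in auto)
  then show ?thesis
    by (simp add: sum.cartesian_product)
qed

lemma card_digit_blocks:
  assumes "g > 0" "D \<subseteq> {..<g}"
  shows "card (digit_blocks g D K) = card D ^ K"
proof (induction K)
  case (Suc K)
  then show ?case
    using sum_digit_blocks_Suc[OF assms, of "\<lambda>_. 1 :: nat" K] by simp
qed simp

section \<open>Splitting off digits in the missing digits set\<close>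

lemma missing_digits_set_iff:
  assumes "g > 0" "D \<subseteq> {..<g}"
  shows "n \<in> missing_digits_set g D \<longleftrightarrow>
    n \<in> D \<or> n div g \<in> missing_digits_set g D \<and> n mod g \<in> D"
proof -
  have shift: "(\<Sum>i\<le>Suc m. w i * g ^ i) = w 0 + g * (\<Sum>i\<le>m. w (Suc i) * g ^ i)" for m and w :: "nat \<Rightarrow> nat"
    by (subst sum.atMost_Suc_shift) (simp add: sum_distrib_left mult_ac)
  show ?thesis
  proof
    assume "n \<in> missing_digits_set g D"
    then obtain m w where n: "n = (\<Sum>i\<le>m. w i * g ^ i)" and w: "\<forall>i\<le>m. w i \<in> D"
      by (auto simp: missing_digits_set_def)
    show "n \<in> D \<or> n div g \<in> missing_digits_set g D \<and> n mod g \<in> D"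
    \<comment> \<open>A string of length one has quotient 0 by \<open>g\<close>, which lies in the
      set only if 0 is a digit; hence the separate disjunct \<open>n \<in> D\<close>.\<close>
    proof (cases m)
      case 0
      then show ?thesis using n w by simp
    next
      case (Suc m')
      have "w 0 \<in> D" "w 0 < g"
        using w assms by auto
      then have "n mod g = w 0" "n div g = (\<Sum>i\<le>m'. w (Suc i) * g ^ i)"
        using n shift[of w m'] Suc assms by simp_all
      moreover have "(\<Sum>i\<le>m'. w (Suc i) * g ^ i) \<in> missing_digits_set g D"
        using w Suc unfolding missing_digits_set_def
        by (intro CollectI exI[of _ m'] exI[of _ "\<lambda>i. w (Suc i)"]) auto
      ultimately show ?thesis
        using \<open>w 0 \<in> D\<close> by simp
    qed
  next
    assume "n \<in> D \<or> n div g \<in> missing_digits_set g D \<and> n mod g \<in> D"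
    then show "n \<in> missing_digits_set g D"
    proof
      assume "n \<in> D"
      then show ?thesis
        unfolding missing_digits_set_def
        by (intro CollectI exI[of _ 0] exI[of _ "\<lambda>_. n"]) auto
    next
      assume *: "n div g \<in> missing_digits_set g D \<and> n mod g \<in> D"
      then obtain m w where q: "n div g = (\<Sum>i\<le>m. w i * g ^ i)" and w: "\<forall>i\<le>m. w i \<in> D"
        by (auto simp: missing_digits_set_def)
      define w' where "w' i = (case i of 0 \<Rightarrow> n mod g | Suc j \<Rightarrow> w j)" for i
      have "(\<Sum>i\<le>Suc m. w' i * g ^ i) = n mod g + g * (n div g)"
        unfolding shift q by (simp add: w'_def)
      moreover have "\<forall>i\<le>Suc m. w' i \<in> D"
        using w * by (auto simp: w'_def split: nat.split)
      ultimately show ?thesis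
        unfolding missing_digits_set_def by (intro CollectI exI[of _ "Suc m"] exI[of _ w']) auto
    qed
  qed
qed

lemma missing_digits_set_digit:
  assumes "g > 0" "D \<subseteq> {..<g}" "n < g"
  shows "n \<in> missing_digits_set g D \<longleftrightarrow> n \<in> D"
  using missing_digits_set_iff[OF assms(1,2), of n] assms(3) by auto

text \<open>Since \<open>q > 0\<close>, all \<open>K\<close> low positions lie below a nonzero
  digit, so even zeros there are genuine digits. The induction moves the top digit of
  \<open>r\<close> over to \<open>q\<close>.\<close>

lemma missing_digits_set_append_iff:
  assumes "g > 0" "D \<subseteq> {..<g}" "r < g ^ K" "q > 0"
  shows "r + g ^ K * q \<in> missing_digits_set g D \<longleftrightarrow>
    r \<in> digit_blocks g D K \<and> q \<in> missing_digits_set g D"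
  using assms(3,4)
proof (induction K arbitrary: r q)
  case 0
  then show ?case by simp
next
  case (Suc K)
  define s e where "s = r mod g ^ K" and "e = r div g ^ K"
  have r: "r = s + g ^ K * e"
    by (simp add: s_def e_def)
  have s: "s < g ^ K" and e: "e < g"
    using assms(1) Suc.prems by (simp_all add: s_def e_def less_mult_imp_div_less)
  have eq: "r + g ^ Suc K * q = s + g ^ K * (e + g * q)"
    by (simp add: r algebra_simps)
  \<comment> \<open>A number with at least two digits is not itself in \<open>D\<close>, so only the
    recursive disjunct is left.\<close>
  have "e + g * q \<ge> g"
    using Suc.prems by (simp add: trans_le_add2)
  then have "e + g * q \<notin> D"
    using assms(2) by auto
  then have "e + g * q \<in> missing_digits_set g D \<longleftrightarrow> q \<in> missing_digits_set g D \<and> e \<in> D"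
    using missing_digits_set_iff[OF assms(1,2), of "e + g * q"] e by simp
  moreover have "e + g * q > 0"
    using Suc.prems assms(1) by simp
  ultimately show ?case
    unfolding eq using Suc.IH[OF s, of "e + g * q"] digit_blocks_Suc_iff[OF assms(1,2) s, of e] r
    by auto
qed

section \<open>Equidistribution of digit blocks\<close>

text \<open>A digit \<open>d\<close> at position \<open>i\<close> adds
  \<open>(u * g ^ i + v) * d\<close> to the statistic, independently of the other digits, so the
  character sum is a product over positions.\<close>

lemma sum_additive_char_digit_blocks:
  assumes "g \<ge> 2" "D \<subseteq> {..<g}"
  shows "(\<Sum>r\<in>digit_blocks g D K. additive_char A (k * int (digit_stat g u v r))) =
    (\<Prod>i<K. \<Sum>d\<in>D. additive_char A (k * int (u * g ^ i + v) * int d))"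
proof (induction K)
  case 0
  then show ?case by (simp add: digit_stat_def)
next
  case (Suc K)
  let ?\<chi> = "\<lambda>r. additive_char A (k * int (digit_stat g u v r))"
  have "?\<chi> (r + g ^ K * d) = ?\<chi> r * additive_char A (k * int (u * g ^ K + v) * int d)"
    if "d \<in> D" "r \<in> digit_blocks g D K" for d r
  proof -
    have "r < g ^ K" "d < g"
      using that assms digit_blocks_less by auto
    then show ?thesis
      using assms(1) digit_stat_append[of g r K u v d] digit_stat_digit[of g d "u * g ^ K" v]
      by (simp add: algebra_simps flip: additive_char_add)
  qed
  then have "sum ?\<chi> (digit_blocks g D (Suc K)) =
      (\<Sum>d\<in>D. \<Sum>r\<in>digit_blocks g D K.
        ?\<chi> r * additive_char A (k * int (u * g ^ K + v) * int d))"
    using assms by (subst sum_digit_blocks_Suc) (auto intro!: sum.cong)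
  also have "\<dots> = sum ?\<chi> (digit_blocks g D K) *
      (\<Sum>d\<in>D. additive_char A (k * int (u * g ^ K + v) * int d))"
    by (simp add: sum_product sum.swap[of _ D])
  finally show ?case
    using Suc.IH by simp
qed

text \<open>The indicator of a residue class minus its mean: summed over a set, it gives the
  deviation of the count from the proportion \<open>1 / A\<close>.\<close>

definition residue_weight :: "nat \<Rightarrow> int \<Rightarrow> nat \<Rightarrow> real" where
  "residue_weight A x n = of_bool (int A dvd int n - x) - 1 / real A"

lemma abs_residue_weight_le_1:
  assumes "A > 0"
  shows "\<bar>residue_weight A x n\<bar> \<le> 1"
  using assms by (simp add: residue_weight_def)

lemma residue_weight_add: "residue_weight A x (m + n) = residue_weight A (x - int n) m"
  by (simp add: residue_weight_def algebra_simps)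

text \<open>Orthogonality of characters; leaving out the trivial character \<open>k = 0\<close> is
  what subtracts the mean.\<close>

lemma residue_weight_eq_sum_additive_char:
  assumes "A > 0"
  shows "of_real (real A * residue_weight A x n) =
    (\<Sum>k\<in>{0<..<A}. additive_char A (int k * (int n - x)))"
proof -
  have "{..<A} = insert 0 {0<..<A}"
    using assms by auto
  then have sum: "(\<Sum>k\<in>{0<..<A}. additive_char A (int k * (int n - x))) =
      (\<Sum>k<A. additive_char A (int k * (int n - x))) - 1"
    by simp
  have weight: "complex_of_real (real A * residue_weight A x n) =
      (if int A dvd int n - x then of_nat A else 0) - 1"
    using assms by (simp add: residue_weight_def right_diff_distrib)
  show ?thesis
    unfolding sum weight sum_additive_char[OF assms] ..
qed

text \<open>The weight is expanded in nontrivial characters. Each of their sums is a product of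
  \<open>K\<close> factors of norm at most \<open>\<rho> * card D\<close>, and there are fewer than
  \<open>A\<close> of them, which the factor \<open>1 / A\<close> absorbs.\<close>

lemma digit_blocks_equidistributed:
  fixes \<rho> :: real
  assumes "g \<ge> 2" "D \<subseteq> {..<g}" "A > 0" "\<rho> \<ge> 0"
    and bound: "\<And>k i. k \<in> {0<..<A} \<Longrightarrow>
      norm (\<Sum>d\<in>D. additive_char A (int k * int (u * g ^ i + v) * int d)) \<le> \<rho> * card D"
  shows "\<bar>\<Sum>r\<in>digit_blocks g D K. residue_weight A x (digit_stat g u v r)\<bar> \<le> (\<rho> * card D) ^ K"
proof -
  let ?R = "digit_blocks g D K" and ?s = "digit_stat g u v"
  have "of_real (real A * (\<Sum>r\<in>?R. residue_weight A x (?s r))) =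
      (\<Sum>r\<in>?R. \<Sum>k\<in>{0<..<A}. additive_char A (int k * (int (?s r) - x)))"
    unfolding sum_distrib_left of_real_sum residue_weight_eq_sum_additive_char[OF assms(3)] ..
  also have "\<dots> = (\<Sum>k\<in>{0<..<A}. \<Sum>r\<in>?R. additive_char A (int k * (int (?s r) - x)))"
    by (rule sum.swap)
  also have "\<dots> = (\<Sum>k\<in>{0<..<A}. additive_char A (- (int k * x)) *
      (\<Prod>i<K. \<Sum>d\<in>D. additive_char A (int k * int (u * g ^ i + v) * int d)))"
    unfolding sum_additive_char_digit_blocks[OF assms(1,2), symmetric]
    by (simp add: sum_distrib_left algebra_simps flip: additive_char_add)
  finally have eq: "of_real (real A * (\<Sum>r\<in>?R. residue_weight A x (?s r))) = \<dots>" .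
  have "real A * \<bar>\<Sum>r\<in>?R. residue_weight A x (?s r)\<bar> =
      norm (of_real (real A * (\<Sum>r\<in>?R. residue_weight A x (?s r))) :: complex)"
    by (simp add: abs_mult del: of_real_mult of_real_sum)
  also have "\<dots> \<le> (\<Sum>k\<in>{0<..<A}. norm (additive_char A (- (int k * x)) *
      (\<Prod>i<K. \<Sum>d\<in>D. additive_char A (int k * int (u * g ^ i + v) * int d))))"
    unfolding eq by (rule norm_sum)
  also have "\<dots> \<le> (\<Sum>k\<in>{0<..<A}. (\<rho> * real (card D)) ^ K)"
  proof (rule sum_mono)
    fix k assume "k \<in> {0<..<A}"
    then have "(\<Prod>i<K. norm (\<Sum>d\<in>D. additive_char A (int k * int (u * g ^ i + v) * int d)))
        \<le> (\<Prod>i<K. \<rho> * card D)"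
      using bound by (intro prod_mono) auto
    then show "norm (additive_char A (- (int k * x)) *
        (\<Prod>i<K. \<Sum>d\<in>D. additive_char A (int k * int (u * g ^ i + v) * int d)))
        \<le> (\<rho> * card D) ^ K"
      by (simp add: norm_mult prod_norm)
  qed
  also have "\<dots> \<le> real A * (\<rho> * card D) ^ K"
    using assms(4) by (simp add: mult_right_mono)
  finally show ?thesis
    using assms(3) by simp
qed

section \<open>Counting in initial segments\<close>

lemma sum_append_blocks:
  assumes "finite Q" "g > 0"
  shows "sum f ((\<lambda>(q, r). r + g ^ K * q) ` (Q \<times> digit_blocks g D K)) =
    (\<Sum>q\<in>Q. \<Sum>r\<in>digit_blocks g D K. f (r + g ^ K * q))"
proof -
  have "inj_on (\<lambda>(q, r). r + g ^ K * q) (Q \<times> digit_blocks g D K)"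
  proof (rule inj_on_inverseI)
    show "(\<lambda>n. (n div g ^ K, n mod g ^ K)) (case x of (q, r) \<Rightarrow> r + g ^ K * q) = x"
      if "x \<in> Q \<times> digit_blocks g D K" for x
      using that digit_blocks_less assms(2) by auto
  qed
  then show ?thesis
    by (simp add: sum.reindex sum.cartesian_product case_prod_unfold)
qed

text \<open>Needed twice: with \<open>{0<..<M}\<close> for the bulk of an initial segment, and with
  \<open>{0<..<g}\<close> for the numbers of a fixed length.\<close>

lemma missing_digits_set_block_image:
  assumes "g > 0" "D \<subseteq> {..<g}" "\<And>q. q \<in> Q \<Longrightarrow> q > 0"
  shows "(\<lambda>(q, r). r + g ^ K * q) ` ((missing_digits_set g D \<inter> Q) \<times> digit_blocks g D K) =
    {n \<in> missing_digits_set g D. n div g ^ K \<in> Q}" (is "?L = ?R")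
proof
  show "?L \<subseteq> ?R"
    using assms digit_blocks_less missing_digits_set_append_iff[OF assms(1,2)] by auto
  show "?R \<subseteq> ?L"
  proof
    fix n assume n: "n \<in> ?R"
    have "n mod g ^ K < g ^ K"
      using assms(1) by simp
    with n have "n div g ^ K \<in> missing_digits_set g D" "n mod g ^ K \<in> digit_blocks g D K"
      using missing_digits_set_append_iff[OF assms(1,2), of "n mod g ^ K" K "n div g ^ K"] assms(3)
      by auto
    with n show "n \<in> ?L"
      by (intro image_eqI[where x = "(n div g ^ K, n mod g ^ K)"]) simp_all
  qed
qed

text \<open>Elements are grouped by their quotient by \<open>g ^ K\<close>. A complete group is a
  translate of the full set of blocks and nearly balanced; the two exceptional groups are bounded
  trivially.\<close>

lemma abs_sum_residue_weight_le:
  fixes \<rho> :: real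
  assumes "g \<ge> 2" "D \<subseteq> {..<g}" "A > 0" "\<rho> \<ge> 0"
    and bound: "\<And>k i. k \<in> {0<..<A} \<Longrightarrow>
      norm (\<Sum>d\<in>D. additive_char A (int k * int (u * g ^ i + v) * int d)) \<le> \<rho> * card D"
  shows "\<bar>\<Sum>n\<in>missing_digits_set g D \<inter> {0..<N}. residue_weight A x (digit_stat g u v n)\<bar>
    \<le> \<rho> ^ K * card (missing_digits_set g D \<inter> {0..<N}) + 2 * real (g ^ K)"
proof -
  let ?X = "missing_digits_set g D \<inter> {0..<N}" and ?R = "digit_blocks g D K"
    and ?w = "\<lambda>n. residue_weight A x (digit_stat g u v n)"
  define M where "M = N div g ^ K"
  define Q where "Q = missing_digits_set g D \<inter> {0<..<M}"
  define F where "F = (\<lambda>(q, r). r + g ^ K * q) ` (Q \<times> ?R)"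
  have g: "g > 0"
    using assms(1) by simp
  have F: "F = {n \<in> missing_digits_set g D. n div g ^ K \<in> {0<..<M}}"
    unfolding F_def Q_def using g assms(2) by (intro missing_digits_set_block_image) auto
  have finQ: "finite Q"
    by (simp add: Q_def)
  have "F \<subseteq> ?X"
  proof
    fix n assume "n \<in> F"
    then have "n div g ^ K < N div g ^ K" "n \<in> missing_digits_set g D"
      by (auto simp: F M_def)
    then show "n \<in> ?X"
      using div_le_mono[of N n "g ^ K"] by (auto simp: not_le[symmetric])
  qed
  \<comment> \<open>Left out are quotient 0, where leading zeros need not be digits, and quotient
    \<open>M\<close>, whose group may be cut off by \<open>N\<close>.\<close>
  have "?X - F \<subseteq> {0..<g ^ K} \<union> {g ^ K * M..<g ^ K * M + g ^ K}"
  proof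
    fix n assume n: "n \<in> ?X - F"
    then have "n div g ^ K \<le> M" "n div g ^ K \<notin> {0<..<M}"
      by (auto simp: F M_def intro: div_le_mono)
    then consider "n div g ^ K = 0" | "n div g ^ K = M"
      by fastforce
    then show "n \<in> {0..<g ^ K} \<union> {g ^ K * M..<g ^ K * M + g ^ K}"
    proof cases
      case 1
      then show ?thesis
        using g by (simp add: div_eq_0_iff)
    next
      case 2
      then have "n = g ^ K * M + n mod g ^ K"
        by (metis mult_div_mod_eq)
      moreover have "n mod g ^ K < g ^ K"
        using g by simp
      ultimately show ?thesis
        by (metis UnI2 atLeastLessThan_iff le_add1 nat_add_left_cancel_less)
    qed
  qed
  then have "card (?X - F) \<le> card ({0..<g ^ K} \<union> {g ^ K * M..<g ^ K * M + g ^ K})"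
    by (intro card_mono) simp_all
  also have "\<dots> \<le> g ^ K + g ^ K"
    using card_Un_le[of "{0..<g ^ K}" "{g ^ K * M..<g ^ K * M + g ^ K}"] by simp
  finally have rest: "real (card (?X - F)) \<le> 2 * real (g ^ K)"
    by (simp flip: of_nat_power of_nat_add add: mult_2)
  have "\<bar>sum ?w (?X - F)\<bar> \<le> (\<Sum>n\<in>?X - F. 1)"
    using abs_residue_weight_le_1[OF assms(3)]
    by (intro order_trans[OF sum_abs] sum_mono) simp
  with rest have rest': "\<bar>sum ?w (?X - F)\<bar> \<le> 2 * real (g ^ K)"
    by simp
  have "card F = (\<Sum>n\<in>F. 1)"
    by simp
  also have "\<dots> = card Q * card D ^ K"
    unfolding F_def using finQ g assms(2)
    by (subst sum_append_blocks) (simp_all add: card_digit_blocks)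
  finally have cardF: "card F = card Q * card D ^ K" .
  \<comment> \<open>Appending a block to \<open>q\<close> only shifts the target residue
    \<open>x\<close>, and the bound for blocks is uniform in \<open>x\<close>.\<close>
  have "\<bar>sum ?w F\<bar> = \<bar>\<Sum>q\<in>Q. \<Sum>r\<in>?R.
      residue_weight A (x - int (digit_stat g (u * g ^ K) v q)) (digit_stat g u v r)\<bar>"
    unfolding F_def using finQ g assms(1)
    by (subst sum_append_blocks)
      (auto simp: digit_stat_append digit_blocks_less residue_weight_add cong: sum.cong)
  also have "\<dots> \<le> (\<Sum>q\<in>Q. (\<rho> * card D) ^ K)"
    by (intro order_trans[OF sum_abs] sum_mono digit_blocks_equidistributed assms)
  also have "\<dots> = \<rho> ^ K * card F"
    by (simp add: cardF power_mult_distrib)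
  also have "\<dots> \<le> \<rho> ^ K * card ?X"
    using \<open>F \<subseteq> ?X\<close> assms(4) by (intro mult_left_mono) (simp_all add: card_mono)
  finally have "\<bar>sum ?w F\<bar> \<le> \<rho> ^ K * card ?X" .
  moreover have "sum ?w ?X = sum ?w (?X - F) + sum ?w F"
    using \<open>F \<subseteq> ?X\<close> by (intro sum.subset_diff) simp_all
  ultimately show ?thesis
    using rest' by linarith
qed

section \<open>Numbers of a given length and growth of the counts\<close>

lemma missing_digits_set_level:
  assumes "g > 0" "D \<subseteq> {..<g}"
  shows "missing_digits_set g D \<inter> {g ^ k..<g ^ Suc k} =
    (\<lambda>(q, r). r + g ^ k * q) ` ((D - {0}) \<times> digit_blocks g D k)"
proof -
  \<comment> \<open>The quotient by \<open>g ^ k\<close> is the leading digit, hence nonzero; the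
    \<open>k\<close> digits below it are free.\<close>
  have "missing_digits_set g D \<inter> {0<..<g} = D - {0}"
    using missing_digits_set_digit[OF assms] assms(2) by auto
  moreover have "n div g ^ k \<in> {0<..<g} \<longleftrightarrow> n \<in> {g ^ k..<g ^ Suc k}" for n
    using assms(1) by (auto simp: div_greater_zero_iff div_less_iff_less_mult)
  ultimately show ?thesis
    using missing_digits_set_block_image[OF assms, of "{0<..<g}" k] by auto
qed

lemma card_missing_digits_set_level:
  assumes "g > 0" "D \<subseteq> {..<g}"
  shows "card (missing_digits_set g D \<inter> {g ^ k..<g ^ Suc k}) = card (D - {0}) * card D ^ k"
proof -
  have "finite (D - {0})"
    using assms(2) finite_subset by blast
  then show ?thesis
    using sum_append_blocks[of "D - {0}" g "\<lambda>_. 1 :: nat" k D] assms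
    by (simp add: missing_digits_set_level card_digit_blocks del: power_Suc)
qed

lemma card_missing_digits_set_power_Suc:
  assumes "g > 0" "D \<subseteq> {..<g}"
  shows "card (missing_digits_set g D \<inter> {0..<g ^ Suc k}) =
    card (missing_digits_set g D \<inter> {0..<g ^ k}) + card (D - {0}) * card D ^ k"
proof -
  have "g ^ k \<le> g ^ Suc k"
    using assms(1) by simp
  then have "missing_digits_set g D \<inter> {0..<g ^ Suc k} =
      missing_digits_set g D \<inter> {0..<g ^ k} \<union> missing_digits_set g D \<inter> {g ^ k..<g ^ Suc k}"
    by (auto simp del: power_Suc)
  then have "card (missing_digits_set g D \<inter> {0..<g ^ Suc k}) =
      card (missing_digits_set g D \<inter> {0..<g ^ k}) +
      card (missing_digits_set g D \<inter> {g ^ k..<g ^ Suc k})"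
    by (simp only:) (subst card_Un_disjoint; auto)
  then show ?thesis
    by (simp only: card_missing_digits_set_level[OF assms])
qed

lemma card_nonzero_digits:
  fixes D :: "nat set"
  assumes "D \<subseteq> {..<g}" "card D \<ge> 2"
  shows "1 \<le> card (D - {0})" "card (D - {0}) \<le> card D"
  using assms finite_subset[OF assms(1)] diff_card_le_card_Diff[of "{0}" D]
  by (auto intro: card_mono)

text \<open>The numbers of length \<open>k + 1\<close> alone number at least
  \<open>card D ^ k\<close>, which is at least \<open>2 ^ k\<close>.\<close>

lemma filterlim_card_missing_digits_set:
  assumes "g > 0" "D \<subseteq> {..<g}" "card D \<ge> 2"
  shows "filterlim (\<lambda>N. real (card (missing_digits_set g D \<inter> {0..<N}))) at_top sequentially"
proof -
  have "k \<le> card (missing_digits_set g D \<inter> {0..<N})" if "N \<ge> g ^ Suc k" for k N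
  proof -
    have "k \<le> 2 ^ k"
      by simp
    also have "\<dots> \<le> card D ^ k"
      using assms(3) by (rule power_mono) simp
    also have "\<dots> \<le> card (missing_digits_set g D \<inter> {0..<g ^ Suc k})"
      using card_missing_digits_set_power_Suc[OF assms(1,2), of k] card_nonzero_digits[OF assms(2,3)]
      by (simp add: trans_le_add2)
    also have "\<dots> \<le> card (missing_digits_set g D \<inter> {0..<N})"
      using that by (intro card_mono) auto
    finally show ?thesis .
  qed
  then have "filterlim (\<lambda>N. card (missing_digits_set g D \<inter> {0..<N})) at_top sequentially"
    unfolding filterlim_at_top eventually_sequentially by blast
  then show ?thesis
    by (rule filterlim_compose[OF filterlim_real_sequentially])
qed

text \<open>By geometric growth at most \<open>2 * card D ^ k\<close> elements lie below
  \<open>g ^ k\<close>, while the next level adds at least \<open>card D ^ k\<close>. So the count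
  grows by a factor of at least 3/2.\<close>

lemma card_missing_digits_set_power_Suc_ge:
  assumes "g > 0" "D \<subseteq> {..<g}" "card D \<ge> 2"
  shows "3 * card (missing_digits_set g D \<inter> {0..<g ^ k}) \<le>
    2 * card (missing_digits_set g D \<inter> {0..<g ^ Suc k})"
proof -
  note digits = card_nonzero_digits[OF assms(2,3)]
  have "card (missing_digits_set g D \<inter> {0..<g ^ k}) \<le> 2 * card D ^ k"
  proof (induction k)
    case 0
    have "card (missing_digits_set g D \<inter> {0..<1}) \<le> card {0::nat}"
      by (intro card_mono) auto
    then show ?case by simp
  next
    case (Suc k)
    have "card (missing_digits_set g D \<inter> {0..<g ^ Suc k}) \<le> 2 * card D ^ k + card D * card D ^ k"
      unfolding card_missing_digits_set_power_Suc[OF assms(1,2)]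
      using Suc digits by (intro add_mono mult_right_mono) simp_all
    \<comment> \<open>This is \<open>2 + card D \<le> 2 * card D\<close>, true from two digits
      on.\<close>
    also have "\<dots> \<le> 2 * card D ^ Suc k"
      using assms(3) by simp
    finally show ?case .
  qed
  moreover have "card D ^ k \<le> card (D - {0}) * card D ^ k"
    using digits by simp
  moreover have "3 * B \<le> 2 * (B + q)" if "B \<le> 2 * p" "p \<le> q" for B p q :: nat
    using that by presburger
  ultimately show ?thesis
    unfolding card_missing_digits_set_power_Suc[OF assms(1,2)] by blast
qed

section \<open>The limit and its obstruction\<close>

text \<open>The relative error is at most \<open>\<rho> ^ K\<close> plus a boundary term that
  vanishes as \<open>N\<close> grows with \<open>K\<close> fixed.\<close>

lemma residue_density:
  fixes \<rho> :: real
  assumes "g \<ge> 2" "D \<subseteq> {..<g}" "card D \<ge> 2" "A > 0" "0 \<le> \<rho>" "\<rho> < 1"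
    and bound: "\<And>k i. k \<in> {0<..<A} \<Longrightarrow>
      norm (\<Sum>d\<in>D. additive_char A (int k * int (u * g ^ i + v) * int d)) \<le> \<rho> * card D"
  shows "(\<lambda>N. real (card ({n \<in> missing_digits_set g D. int A dvd int (digit_stat g u v n) - x} \<inter> {0..<N}))
      / real (card (missing_digits_set g D \<inter> {0..<N}))) \<longlonglongrightarrow> 1 / real A"
proof -
  define B where "B N = missing_digits_set g D \<inter> {0..<N}" for N
  define E where "E N = (\<Sum>n\<in>B N. residue_weight A x (digit_stat g u v n))" for N
  have lim: "filterlim (\<lambda>N. real (card (B N))) at_top sequentially"
    unfolding B_def using assms by (intro filterlim_card_missing_digits_set) simp_all
  have E: "E N = real (card ({n \<in> missing_digits_set g D. int A dvd int (digit_stat g u v n) - x} \<inter> {0..<N}))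
      - card (B N) / A" for N
  proof -
    have "{n \<in> missing_digits_set g D. int A dvd int (digit_stat g u v n) - x} \<inter> {0..<N} =
        B N \<inter> {n. int A dvd int (digit_stat g u v n) - x}"
      by (auto simp: B_def)
    then show ?thesis
      by (simp add: E_def residue_weight_def sum_subtractf B_def)
  qed
  have "(\<lambda>N. E N / card (B N)) \<longlonglongrightarrow> 0"
  proof (rule LIMSEQ_I)
    fix \<epsilon> :: real assume "\<epsilon> > 0"
    \<comment> \<open>\<open>K\<close> is fixed first; the threshold
      \<open>4 * g ^ K / \<epsilon>\<close> for the count then makes the boundary term
      \<open>2 * g ^ K\<close> less than \<epsilon>/2 of it.\<close>
    obtain K where K: "\<rho> ^ K < \<epsilon> / 2"
      using real_arch_pow_inv[of "\<epsilon> / 2" \<rho>] assms(6) \<open>\<epsilon> > 0\<close> by auto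
    have "\<forall>\<^sub>F N in sequentially. real (card (B N)) > 4 * real (g ^ K) / \<epsilon>"
      using lim by (simp add: filterlim_at_top_dense)
    then obtain N0 where N0: "\<And>N. N \<ge> N0 \<Longrightarrow> real (card (B N)) > 4 * real (g ^ K) / \<epsilon>"
      unfolding eventually_sequentially by blast
    have "norm (E N / card (B N) - 0) < \<epsilon>" if "N \<ge> N0" for N
    proof -
      have pos: "real (card (B N)) > 0"
        using N0[OF that] \<open>\<epsilon> > 0\<close> by (smt (verit) divide_nonneg_pos of_nat_0_le_iff)
      have "\<bar>E N\<bar> \<le> \<rho> ^ K * card (B N) + 2 * real (g ^ K)"
        unfolding E_def B_def by (intro abs_sum_residue_weight_le assms)
      also have "\<dots> < \<epsilon> / 2 * card (B N) + \<epsilon> / 2 * card (B N)"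
        using K pos N0[OF that] \<open>\<epsilon> > 0\<close>
        by (intro add_strict_mono mult_strict_right_mono) (simp_all add: field_simps)
      finally show ?thesis
        using pos by (simp add: field_simps)
    qed
    then show "\<exists>N0. \<forall>N\<ge>N0. norm (E N / card (B N) - 0) < \<epsilon>"
      by blast
  qed
  then have "(\<lambda>N. 1 / real A + E N / card (B N)) \<longlonglongrightarrow> 1 / real A + 0"
    by (intro tendsto_intros)
  moreover have "\<forall>\<^sub>F N in sequentially. real (card (B N)) > 0"
    using lim unfolding filterlim_at_top_dense by blast
  then have "\<forall>\<^sub>F N in sequentially. 1 / real A + E N / card (B N) =
      real (card ({n \<in> missing_digits_set g D. int A dvd int (digit_stat g u v n) - x} \<inter> {0..<N}))
      / real (card (missing_digits_set g D \<inter> {0..<N}))"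
  proof eventually_elim
    case (elim N)
    then show ?case
      unfolding E B_def[symmetric] by (simp add: diff_divide_distrib)
  qed
  ultimately show ?thesis
    by (simp add: tendsto_cong)
qed

text \<open>The statistic is linear in the digits of a string of fixed length, so replacing digits
  by others congruent modulo \<open>m\<close> does not change it modulo \<open>m\<close>.\<close>

lemma digit_stat_blocks_dvd_diff:
  assumes "g \<ge> 2" "D \<subseteq> {..<g}" "\<And>d e. d \<in> D \<Longrightarrow> e \<in> D \<Longrightarrow> m dvd int d - int e"
    and "r \<in> digit_blocks g D K" "s \<in> digit_blocks g D K"
  shows "m dvd int (digit_stat g u v r) - int (digit_stat g u v s)"
  using assms(4,5)
proof (induction K arbitrary: r s)
  case 0
  then show ?case by simp
next
  case (Suc K)
  have split: "n mod g ^ K \<in> digit_blocks g D K \<and> n div g ^ K \<in> D \<and>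
      digit_stat g u v n = digit_stat g u v (n mod g ^ K) + (u * g ^ K + v) * (n div g ^ K)"
    if "n \<in> digit_blocks g D (Suc K)" for n
  proof -
    have less: "n mod g ^ K < g ^ K"
      using assms(1) by simp
    then have n: "n mod g ^ K \<in> digit_blocks g D K" "n div g ^ K \<in> D"
      using that assms(1) digit_blocks_Suc_iff[OF _ assms(2) less, of "n div g ^ K"] by simp_all
    then have "n div g ^ K < g"
      using assms(2) by auto
    then show ?thesis
      using n digit_stat_append[OF assms(1) less, of u v "n div g ^ K"]
        digit_stat_digit[OF assms(1), of "n div g ^ K" "u * g ^ K" v] by simp
  qed
  have "m dvd (int (digit_stat g u v (r mod g ^ K)) - int (digit_stat g u v (s mod g ^ K)))
      + int (u * g ^ K + v) * (int (r div g ^ K) - int (s div g ^ K))"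
    using split[OF Suc.prems(1)] split[OF Suc.prems(2)] Suc.IH assms(3)
    by (intro dvd_add dvd_mult) blast+
  then show ?case
    using split[OF Suc.prems(1)] split[OF Suc.prems(2)] by (simp add: algebra_simps)
qed

text \<open>If a level has no element with \<open>P\<close>, the numerator stays the same across it
  while the denominator grows by a factor of at least 3/2. The ratio then drops to at most 2/3 of
  its value, which cannot persist near a positive limit.\<close>

lemma eventually_level_meets:
  assumes "g \<ge> 2" "D \<subseteq> {..<g}" "card D \<ge> 2" "c > 0"
    and lim: "(\<lambda>N. real (card ({n \<in> missing_digits_set g D. P n} \<inter> {0..<N}))
      / real (card (missing_digits_set g D \<inter> {0..<N}))) \<longlonglongrightarrow> c"
  shows "\<forall>\<^sub>F k in sequentially. \<exists>n \<in> missing_digits_set g D \<inter> {g ^ k..<g ^ Suc k}. P n"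
proof -
  define f where "f k = real (card ({n \<in> missing_digits_set g D. P n} \<inter> {0..<g ^ k}))" for k
  define B where "B k = real (card (missing_digits_set g D \<inter> {0..<g ^ k}))" for k
  have "filterlim (\<lambda>k. g ^ k) sequentially sequentially"
    using assms(1) by (intro filterlim_subseq strict_monoI power_strict_increasing) auto
  from filterlim_compose[OF lim this] have lim1: "(\<lambda>k. f k / B k) \<longlonglongrightarrow> c"
    unfolding f_def B_def .
  then have lim2: "(\<lambda>k. f (Suc k) / B (Suc k)) \<longlonglongrightarrow> c"
    by (rule LIMSEQ_Suc)
  \<comment> \<open>The constants are tuned so that 2/3 of \<open>6 / 5 * c\<close> is exactly
    \<open>4 / 5 * c\<close>.\<close>
  have "\<forall>\<^sub>F k in sequentially. f k / B k < 6 / 5 * c"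
    using lim1 assms(4) by (intro order_tendstoD(2)[of _ c]) simp_all
  moreover have "\<forall>\<^sub>F k in sequentially. f (Suc k) / B (Suc k) > 4 / 5 * c"
    using lim2 assms(4) by (intro order_tendstoD(1)[of _ c]) simp_all
  moreover have "\<forall>\<^sub>F k in sequentially. f k / B k > 0"
    using lim1 assms(4) by (intro order_tendstoD(1)[of _ c]) simp_all
  ultimately show ?thesis
  proof eventually_elim
    case (elim k)
    show ?case
    proof (rule ccontr)
      assume none: "\<not> ?thesis"
      have "g ^ k \<le> g ^ Suc k"
        using assms(1) by simp
      moreover have "n < g ^ k" if "n \<in> missing_digits_set g D" "P n" "n < g ^ Suc k" for n
        using none that by (meson IntI atLeastLessThan_iff not_le)
      ultimately have "{n \<in> missing_digits_set g D. P n} \<inter> {0..<g ^ Suc k} =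
          {n \<in> missing_digits_set g D. P n} \<inter> {0..<g ^ k}"
        by (auto simp del: power_Suc intro: less_le_trans)
      then have "f (Suc k) = f k"
        by (simp only: f_def)
      moreover have B: "3 / 2 * B k \<le> B (Suc k)"
        using card_missing_digits_set_power_Suc_ge[of g D k] assms(1-3)
        unfolding B_def by (simp only: of_nat_le_iff[symmetric, where 'a = real]) simp
      moreover have pos: "f k > 0" "B k > 0"
        using elim(3) by (auto simp: f_def B_def zero_less_divide_iff)
      ultimately have "f (Suc k) / B (Suc k) \<le> f k / (3 / 2 * B k)"
        by (simp only:) (intro divide_left_mono; simp)
      also have "\<dots> = 2 / 3 * (f k / B k)"
        by simp
      also have "\<dots> < 2 / 3 * (6 / 5 * c)"
        using elim(1) by (intro mult_strict_left_mono) simp_all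
      finally show False
        using elim(2) by simp
    qed
  qed
qed

section \<open>One congruence in place of two, and the equivalence\<close>

lemma cong_pair_iff_dvd_digit_stat:
  fixes a a' :: nat and b b' :: int
  assumes "coprime a a'"
  shows "[int n = b] (mod int a) \<and> [int (digit_sum g n) = b'] (mod int a') \<longleftrightarrow>
    int (a * a') dvd int (digit_stat g a' a n) - (int a' * b + int a * b')"
proof -
  have cop: "coprime (int a) (int a')"
    using assms by simp
  let ?y = "int a' * (int n - b) + int a * (int (digit_sum g n) - b')"
  \<comment> \<open>Modulo \<open>a\<close> only the term with factor \<open>a'\<close> survives,
    and \<open>a'\<close> is a unit there; the roles are exchanged modulo \<open>a'\<close>.\<close>
  have "int a dvd ?y \<longleftrightarrow> int a dvd int n - b"
    using cop by (simp add: dvd_add_left_iff coprime_dvd_mult_right_iff)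
  moreover have "int a' dvd ?y \<longleftrightarrow> int a' dvd int (digit_sum g n) - b'"
    using cop by (simp add: dvd_add_right_iff coprime_dvd_mult_right_iff coprime_commute)
  moreover have "int a * int a' dvd ?y \<longleftrightarrow> int a dvd ?y \<and> int a' dvd ?y"
    using cop by (auto intro: divides_mult dvd_mult_left dvd_mult_right)
  moreover have "?y = int (digit_stat g a' a n) - (int a' * b + int a * b')"
    by (simp add: digit_stat_def algebra_simps)
  ultimately show ?thesis
    by (simp add: cong_iff_dvd_diff)
qed

theorem theorem1:
  fixes g a a' t :: nat and d :: "nat \<Rightarrow> nat" and D :: "nat set"
  assumes "g \<ge> 2"
    and "a \<ge> 1" and "a' \<ge> 1"
    and "gcd g a = 1" and "gcd a a' = 1"
    and "t \<ge> 2"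
    and "strict_mono_on {1..t} d"
    and "D = d ` {1..t}"
    and "D \<subseteq> {0..g - 1}"
  shows "(\<forall>b b' :: int.
            (\<lambda>N. real (card ({n \<in> missing_digits_set g D.
                               [int n = b] (mod int a) \<and>
                               [int (digit_sum g n) = b'] (mod int a')} \<inter> {0..<N}))
                 / real (card (missing_digits_set g D \<inter> {0..<N})))
            \<longlonglongrightarrow> 1 / real (a * a'))
         \<longleftrightarrow> Gcd (insert (a * a') {d i - d 1 | i. i \<in> {2..t}}) = 1"
proof -
  define A where "A = a * a'"
  define S where "S = {d i - d 1 | i. i \<in> {2..t}}"
  define stat where "stat = digit_stat g a' a"
  let ?C = "missing_digits_set g D"
  have g: "g > 0" and A: "A > 0"
    using assms(1-3) by (simp_all add: A_def)
  have cop: "coprime a a'" "coprime a g"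
    using assms(4,5) by (simp_all add: coprime_iff_gcd_eq_1 gcd.commute)
  have D: "D \<subseteq> {..<g}"
    using assms(1,9) by auto
  have card: "card D = t"
    using strict_mono_on_imp_inj_on[OF assms(7)] assms(8) by (simp add: card_image)
  have cls: "[int n = b] (mod int a) \<and> [int (digit_sum g n) = b'] (mod int a') \<longleftrightarrow>
      int A dvd int (stat n) - (int a' * b + int a * b')" for n b b'
    unfolding A_def stat_def by (rule cong_pair_iff_dvd_digit_stat[OF cop(1)])
  \<comment> \<open>This makes the truncated differences in \<open>S\<close> agree with integer
    differences.\<close>
  have less: "d 1 < d i" if "i \<in> {2..t}" for i
    using that assms(6) by (intro strict_mono_onD[OF assms(7)]) auto
  show ?thesis
    unfolding cls A_def[symmetric] S_def[symmetric]
  proof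
    assume lim: "\<forall>b b'. (\<lambda>N. real (card ({n \<in> ?C. int A dvd int (stat n) -
        (int a' * b + int a * b')} \<inter> {0..<N})) / real (card (?C \<inter> {0..<N}))) \<longlonglongrightarrow> 1 / real A"
    define m where "m = Gcd (insert A S)"
    have "m dvd A"
      unfolding m_def by (rule Gcd_dvd) simp
    have "int m dvd int x - int (d 1)" if x: "x \<in> D" for x
    proof -
      obtain i where i: "i \<in> {1..t}" "x = d i"
        using x assms(8) by auto
      show ?thesis
      proof (cases "i = 1")
        case False
        with i have "i \<in> {2..t}"
          by auto
        then have "m dvd x - d 1"
          unfolding m_def using i by (intro Gcd_dvd) (auto simp: S_def)
        then show ?thesis
          using less[OF \<open>i \<in> {2..t}\<close>] i by (simp flip: of_nat_diff)
      qed (use i in simp)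
    qed
    then have diff: "int m dvd int x - int y" if "x \<in> D" "y \<in> D" for x y
      using dvd_diff[of "int m" "int x - int (d 1)" "int y - int (d 1)"] that by simp
    have meets: "\<forall>\<^sub>F k in sequentially. \<exists>n \<in> ?C \<inter> {g ^ k..<g ^ Suc k}.
        int A dvd int (stat n) - (int a' * b + int a * b')" for b b'
      using assms(1,6) D A card lim by (intro eventually_level_meets[where c = "1 / real A"]) auto
    \<comment> \<open>On a single level all values of \<open>stat\<close> agree modulo \<open>m\<close>, so the classes of
      \<open>(0, 0)\<close> and \<open>(1, 1)\<close> cannot both be met unless \<open>m\<close> divides \<open>a + a'\<close>.\<close>
    obtain k n n' where n: "n \<in> ?C \<inter> {g ^ k..<g ^ Suc k}" "int A dvd int (stat n)"
      and n': "n' \<in> ?C \<inter> {g ^ k..<g ^ Suc k}" "int A dvd int (stat n') - (int a' + int a)"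
      using eventually_happens[OF eventually_conj[OF meets[of 0 0] meets[of 1 1]]] by auto
    have "x \<in> digit_blocks g D (Suc k)" if "x \<in> ?C \<inter> {g ^ k..<g ^ Suc k}" for x
      using that digit_blocks_Suc_iff[OF g D] digit_blocks_less
      unfolding missing_digits_set_level[OF g D] by auto
    then have "int m dvd int (stat n) - int (stat n')"
      unfolding stat_def using n(1) n'(1) assms(1) D diff by (intro digit_stat_blocks_dvd_diff) auto
    moreover have "int m dvd int (stat n)" "int m dvd int (stat n') - (int a' + int a)"
      using n(2) n'(2) \<open>m dvd A\<close> by (meson dvd_trans of_nat_dvd_iff)+
    \<comment> \<open>The combination is chosen so that both values of \<open>stat\<close> cancel
      and \<open>a' + a\<close> remains.\<close>
    ultimately have "int m dvd (int (stat n) - (int (stat n) - int (stat n'))) -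
        (int (stat n') - (int a' + int a))"
      using dvd_diff by blast
    then have "int m dvd int (a' + a)"
      by simp
    then have "m dvd a' + a"
      by (simp only: of_nat_dvd_iff)
    moreover have "coprime a (a' + a)" "coprime a' (a' + a)"
      using cop(1) gcd_add2[of a a'] gcd_add2[of a' a]
      by (simp_all add: coprime_iff_gcd_eq_1 gcd.commute add.commute)
    then have "coprime A (a' + a)"
      by (simp add: A_def)
    ultimately have "m = 1"
      using \<open>m dvd A\<close> coprime_common_divisor_nat by blast
    then show "Gcd (insert A S) = 1"
      by (simp only: m_def)
  next
    assume Gcd: "Gcd (insert A S) = 1"
    \<comment> \<open>\<rho> is fixed before \<open>k\<close> and \<open>i\<close>, so one ratio
      serves all characters and all positions.\<close>
    obtain \<rho> :: real where \<rho>: "0 \<le> \<rho>" "\<rho> < 1"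
      and bound: "\<And>x y z. \<lbrakk>y \<in> D; z \<in> D; \<not> int A dvd x * (int y - int z)\<rbrakk> \<Longrightarrow>
        norm (\<Sum>y\<in>D. additive_char A (x * int y)) \<le> \<rho> * card D"
      using uniform_norm_sum_additive_char[of D A] A assms(6,8) by auto
    have "norm (\<Sum>y\<in>D. additive_char A (int k * int (a' * g ^ i + a) * int y)) \<le> \<rho> * card D"
      if k: "k \<in> {0<..<A}" for k i
    proof -
      let ?x = "k * (a' * g ^ i + a)"
      \<comment> \<open>The coefficient \<open>a' * g ^ i + a\<close> is a unit modulo
        \<open>A\<close>: it reduces to \<open>a' * g ^ i\<close> modulo \<open>a\<close> and to
        \<open>a\<close> modulo \<open>a'\<close>.\<close>
      have "gcd a (a + a' * g ^ i) = gcd a (a' * g ^ i)"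
        by (rule gcd_add2)
      moreover have "coprime a (a' * g ^ i)"
        using cop by simp
      ultimately have "coprime a (a' * g ^ i + a)"
        by (simp only: coprime_iff_gcd_eq_1 add.commute)
      moreover have "gcd a' (g ^ i * a' + a) = gcd a' a"
        by (rule gcd_add_mult)
      then have "coprime a' (a' * g ^ i + a)"
        using cop(1) by (simp only: coprime_iff_gcd_eq_1 gcd.commute mult.commute)
      ultimately have "coprime A (a' * g ^ i + a)"
        by (simp add: A_def)
      then have "\<not> A dvd ?x"
        using k by (simp add: coprime_dvd_mult_left_iff nat_dvd_not_less)
      \<comment> \<open>Otherwise \<open>A\<close> would divide all multiples of \<open>?x\<close>
        by elements of \<open>insert A S\<close>, hence their gcd, which is \<open>?x\<close>
        because the elements have gcd 1.\<close>
      have "\<exists>s\<in>S. \<not> A dvd ?x * s"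
      proof (rule ccontr)
        assume "\<not> ?thesis"
        then have "A dvd Gcd ((*) ?x ` insert A S)"
          by (intro Gcd_greatest) auto
        then show False
          using \<open>\<not> A dvd ?x\<close> unfolding Gcd_mult Gcd by simp
      qed
      then obtain j where j: "j \<in> {2..t}" "\<not> A dvd ?x * (d j - d 1)"
        by (auto simp: S_def)
      then have "\<not> int A dvd int ?x * int (d j - d 1)"
        by (simp only: of_nat_dvd_iff of_nat_mult[symmetric] not_False_eq_True)
      then have "\<not> int A dvd int ?x * (int (d j) - int (d 1))"
        using less[OF j(1)] by (simp only: of_nat_diff less_imp_le_nat not_False_eq_True)
      moreover have "d j \<in> D" "d 1 \<in> D"
        using j(1) assms(6,8) by auto
      ultimately show ?thesis
        using bound[of "d j" "d 1" "int ?x"] by simp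
    qed
    then show "\<forall>b b'. (\<lambda>N. real (card ({n \<in> ?C. int A dvd int (stat n) -
        (int a' * b + int a * b')} \<inter> {0..<N})) / real (card (?C \<inter> {0..<N}))) \<longlonglongrightarrow> 1 / real A"
      unfolding stat_def using assms(1,6) D A card \<rho> by (intro allI residue_density) simp_all
  qed
qed

end
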